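(* Let $n$ be a positive integer and $a,b$ indeterminates. Let $\tilde{\mathcal{G}}_n$ be the cycle with $n$ pendant edges equipped with the orientation in which each cycle edge is oriented $v_i\to v_{i+1}$ (indices mod $n$) and each pendant edge is oriented $v_i'\to v_i$, with nodes $\{v_1',\dots,v_n'\}$ and weights $w(\overrightarrow{v_i'v_i})=a$, $w(\overrightarrow{v_iv_{i+1}})=b$ for $i=1,\dots,n$. Let $\tilde F_n(a,b):=Z^{\mathrm{ori}}(\tilde{\mathcal{G}}_n)$ be the weighted sum of oriented rooted spanning forests. Then \[ \tilde F_n(a,b)=(a+b)^n-b^n. \]
   Context: The cycle with $n$ pendant edges has vertex set $\{v_1,\dots,v_n\}\cup\{v_1',\dots,v_n'\}$, cycle edges $e_i=v_iv_{i+1}$ ($i=1,\dots,n$, indices mod $n$) and pendant edges $e_i'=v_iv_i'$; the nodes are $v_1',\dots,v_n'$ and the internal vertices are $v_1,\dots,v_n$. A rooted spanning forest is a spanning subgraph with no cycles in which each connected component contains exactly one node. An oriented rooted spanning forest of the oriented graph is a rooted spanning forest in which, in each connected component, every edge is oriented (by the fixed orientation) outward, i.e. away from the node of that component. The weighted sum of oriented rooted spanning forests is $Z^{\mathrm{ori}}=\sum_{\mathcal{G}'}\prod_{\vec e\in E(\mathcal{G}')}w(\vec e)$, summed over all oriented rooted spanning forests $\mathcal{G}'$. *)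

theory Defs
  imports "Graph_Theory.Digraph_Component"
begin

text \<open>
  An oriented graph is a \<open>pre_digraph\<close>; loops and parallel edges are allowed.
  Its underlying undirected multigraph is represented by the digraph in which each edge \<open>e\<close> gives
  two arcs: \<open>(e, True)\<close> traverses \<open>e\<close> along its orientation, \<open>(e, False)\<close> against it.
  Walks and paths of this digraph are the walks and paths of the undirected multigraph, and its
  strongly connected components are the connected components.
  The library's \<open>mk_symmetric\<close> is not usable for this, because it merges parallel edges; its
  \<open>forest\<close> only excludes directed cycles.
\<close>

definition undirect :: "('v, 'e) pre_digraph \<Rightarrow> ('v, 'e \<times> bool) pre_digraph" where
  "undirect G = \<lparr> verts = verts G, arcs = arcs G \<times> UNIV,
     tail = (\<lambda>(e, d). if d then tail G e else head G e),
     head = (\<lambda>(e, d). if d then head G e else tail G e) \<rparr>"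

text \<open>
  A cycle of the multigraph uses no edge twice: going forth and back along one edge is a cycle
  of \<open>undirect G\<close> but not an undirected cycle. A loop is a cycle of length 1, and two
  parallel edges form a cycle of length 2.
\<close>

definition undirected_acyclic :: "('v, 'e) pre_digraph \<Rightarrow> bool" where
  "undirected_acyclic G \<longleftrightarrow>
     \<not> (\<exists>p. pre_digraph.cycle (undirect G) p \<and> distinct (map fst p))"

definition components :: "('v, 'e) pre_digraph \<Rightarrow> 'v set set" where
  "components G = pre_digraph.sccs_verts (undirect G)"

definition rooted_spanning_forest ::
  "('v, 'e) pre_digraph \<Rightarrow> 'v set \<Rightarrow> ('v, 'e) pre_digraph \<Rightarrow> bool" where
  "rooted_spanning_forest G N H \<longleftrightarrow>
     spanning H G \<and> undirected_acyclic H \<and> (\<forall>C \<in> components H. \<exists>!r. r \<in> C \<inter> N)"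

text \<open>
  The edge \<open>e\<close> is oriented away from \<open>r\<close> in \<open>H\<close> if some undirected path of \<open>H\<close> that starts at \<open>r\<close>
  ends with \<open>e\<close>, traversed along its orientation. (In a forest, a path is determined by its ends.)
\<close>

definition oriented_away :: "('v, 'e) pre_digraph \<Rightarrow> 'v \<Rightarrow> 'e \<Rightarrow> bool" where
  "oriented_away H r e \<longleftrightarrow>
     (\<exists>p. pre_digraph.apath (undirect H) r (p @ [(e, True)]) (head H e))"

definition oriented_rooted_spanning_forest ::
  "('v, 'e) pre_digraph \<Rightarrow> 'v set \<Rightarrow> ('v, 'e) pre_digraph \<Rightarrow> bool" where
  "oriented_rooted_spanning_forest G N H \<longleftrightarrow>
     rooted_spanning_forest G N H \<and>
     (\<forall>C \<in> components H. \<forall>r \<in> C \<inter> N. \<forall>e \<in> arcs H. tail H e \<in> C \<longrightarrow> oriented_away H r e)"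

definition Z_ori ::
  "('v, 'e) pre_digraph \<Rightarrow> 'v set \<Rightarrow> ('e \<Rightarrow> 'r) \<Rightarrow> 'r::comm_ring_1" where
  "Z_ori G N w = (\<Sum>H | oriented_rooted_spanning_forest G N H. \<Prod>e\<in>arcs H. w e)"


text \<open>
  \<open>Internal i\<close> is $v_i$, \<open>Node i\<close> is $v_i'$, \<open>Cycle_Edge i\<close> is $e_i$ and \<open>Pendant_Edge i\<close> is $e_i'$,
  for \<open>i \<in> {1..n}\<close>. The successor of \<open>i\<close> modulo \<open>n\<close> in \<open>{1..n}\<close> is \<open>i mod n + 1\<close>.
  For \<open>n = 1\<close> the edge $e_1$ is a loop, for \<open>n = 2\<close> the edges $e_1, e_2$ are parallel.
\<close>

datatype pendant_vertex = Internal nat | Node nat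

datatype pendant_edge = Cycle_Edge nat | Pendant_Edge nat

fun pendant_tail :: "pendant_edge \<Rightarrow> pendant_vertex" where
  "pendant_tail (Cycle_Edge i) = Internal i"
| "pendant_tail (Pendant_Edge i) = Node i"

fun pendant_head :: "nat \<Rightarrow> pendant_edge \<Rightarrow> pendant_vertex" where
  "pendant_head n (Cycle_Edge i) = Internal (i mod n + 1)"
| "pendant_head n (Pendant_Edge i) = Internal i"

definition pendant_cycle :: "nat \<Rightarrow> (pendant_vertex, pendant_edge) pre_digraph" where
  "pendant_cycle n = \<lparr> verts = Internal ` {1..n} \<union> Node ` {1..n},
     arcs = Cycle_Edge ` {1..n} \<union> Pendant_Edge ` {1..n},
     tail = pendant_tail, head = pendant_head n \<rparr>"

fun pendant_weight :: "'r \<Rightarrow> 'r \<Rightarrow> pendant_edge \<Rightarrow> 'r" where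
  "pendant_weight a b (Cycle_Edge i) = b"
| "pendant_weight a b (Pendant_Edge i) = a"

definition F_tilde :: "nat \<Rightarrow> 'r \<Rightarrow> 'r \<Rightarrow> 'r::comm_ring_1" where
  "F_tilde n a b = Z_ori (pendant_cycle n) (Node ` {1..n}) (pendant_weight a b)"

lemma fin_digraph_pendant_cycle: "fin_digraph (pendant_cycle n)"
proof
  fix e assume e: "e \<in> arcs (pendant_cycle n)"
  show "tail (pendant_cycle n) e \<in> verts (pendant_cycle n)"
    using e by (auto simp: pendant_cycle_def)
  have "Suc (i mod n) \<le> n" if "Suc 0 \<le> i" "i \<le> n" for i
    using that mod_less_divisor[of n i] by linarith
  then show "head (pendant_cycle n) e \<in> verts (pendant_cycle n)"
    using e by (auto simp: pendant_cycle_def)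
qed (auto simp: pendant_cycle_def)

lemma finite_oriented_rooted_spanning_forests:
  assumes "fin_digraph G"
  shows "finite {H. oriented_rooted_spanning_forest G N H}"
proof (rule finite_subset)
  show "{H. oriented_rooted_spanning_forest G N H} \<subseteq>
      (\<lambda>A. \<lparr>verts = verts G, arcs = A, tail = tail G, head = head G\<rparr>) ` Pow (arcs G)"
  proof
    fix H assume "H \<in> {H. oriented_rooted_spanning_forest G N H}"
    then have "arcs H \<in> Pow (arcs G)"
      and "H = \<lparr>verts = verts G, arcs = arcs H, tail = tail G, head = head G\<rparr>"
      by (auto simp: oriented_rooted_spanning_forest_def rooted_spanning_forest_def spanning_def
          subgraph_def compatible_def)
    then show "H \<in> (\<lambda>A. \<lparr>verts = verts G, arcs = A, tail = tail G, head = head G\<rparr>) ` Pow (arcs G)"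
      by (rule rev_image_eqI)
  qed
  show "finite ((\<lambda>A. \<lparr>verts = verts G, arcs = A, tail = tail G, head = head G\<rparr>) ` Pow (arcs G))"
    using assms by (simp add: fin_digraph.finite_arcs)
qed

end

theory Submission
  imports Defs
begin

text \<open>
  In an oriented rooted spanning forest every internal vertex \<open>v\<^sub>i\<close> has exactly one incoming edge:
  either the pendant edge at \<open>v\<^sub>i\<close>, or the cycle edge from its predecessor. So the forest is
  determined by the set \<open>S\<close> of those \<open>i\<close> whose pendant edge is present, and its weight is
  \<open>a^|S| b^(n - |S|)\<close>. Here \<open>S\<close> is nonempty, since otherwise no node is connected to the cycle.
  Conversely, every nonempty \<open>S\<close> yields a forest: the distance along the cycle from a fixed
  element of \<open>S\<close> increases along every remaining edge, which rules out cycles.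
  Summing over all \<open>S\<close> gives \<open>(a + b)^n\<close>, from which the term \<open>b^n\<close> of the empty set is removed.
\<close>

section \<open>Undirected walks and components\<close>

lemma undirect_simps [simp]:
  "verts (undirect H) = verts H"
  "arcs (undirect H) = arcs H \<times> UNIV"
  "tail (undirect H) (e, d) = (if d then tail H e else head H e)"
  "head (undirect H) (e, d) = (if d then head H e else tail H e)"
  by (simp_all add: undirect_def)

context wf_digraph
begin

lemma wf_digraph_undirect: "wf_digraph (undirect G)"
  by unfold_locales (auto simp: undirect_def split: if_splits)

lemma undirect_dominates:
  assumes "e \<in> arcs G"
  shows "tail G e \<rightarrow>\<^bsub>undirect G\<^esub> head G e" "head G e \<rightarrow>\<^bsub>undirect G\<^esub> tail G e"
proof -
  show "tail G e \<rightarrow>\<^bsub>undirect G\<^esub> head G e"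
    by (rule wf_digraph.dominatesI[OF wf_digraph_undirect, of "(e, True)"])
      (use assms in \<open>auto simp: arc_to_ends_def\<close>)
  show "head G e \<rightarrow>\<^bsub>undirect G\<^esub> tail G e"
    by (rule wf_digraph.dominatesI[OF wf_digraph_undirect, of "(e, False)"])
      (use assms in \<open>auto simp: arc_to_ends_def\<close>)
qed

lemma undirect_dominatesE:
  assumes "u \<rightarrow>\<^bsub>undirect G\<^esub> v"
  obtains e where "e \<in> arcs G" "{u, v} = {tail G e, head G e}"
proof -
  obtain x where "x \<in> arcs (undirect G)" "tail (undirect G) x = u" "head (undirect G) x = v"
    using assms by (rule reachableE)
  then show ?thesis
    using that[of "fst x"] by (cases x) (auto split: if_splits)
qed

lemma undirect_reachable_sym:
  assumes "u \<rightarrow>\<^sup>*\<^bsub>undirect G\<^esub> v"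
  shows "v \<rightarrow>\<^sup>*\<^bsub>undirect G\<^esub> u"
proof (rule symmetric_reachable[OF _ assms])
  show "symmetric (undirect G)"
    unfolding symmetric_def
  proof (rule symI)
    fix x y assume "x \<rightarrow>\<^bsub>undirect G\<^esub> y"
    then obtain e where "e \<in> arcs G" "{x, y} = {tail G e, head G e}"
      by (rule undirect_dominatesE)
    then show "y \<rightarrow>\<^bsub>undirect G\<^esub> x"
      using undirect_dominates[of e] by (auto simp: doubleton_eq_iff)
  qed
qed

lemma reachable_imp_undirect_reachable:
  assumes "u \<rightarrow>\<^sup>* v"
  shows "u \<rightarrow>\<^sup>*\<^bsub>undirect G\<^esub> v"
  using assms
proof (induction rule: reachable_induct)
  case base
  then show ?case
    by (simp add: wf_digraph.reachable_refl[OF wf_digraph_undirect])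
next
  case (step x y)
  then have "x \<rightarrow>\<^bsub>undirect G\<^esub> y"
    using undirect_dominates by auto
  with step.IH show ?case
    by (rule wf_digraph.reachable_adj_trans[OF wf_digraph_undirect])
qed

text \<open>Reachability in \<open>undirect G\<close> is symmetric, so the mutual reachability that
  defines the components only has to be checked in one direction.\<close>

lemma component_iff:
  assumes "C \<in> components G" "v \<in> C"
  shows "u \<in> C \<longleftrightarrow> v \<rightarrow>\<^sup>*\<^bsub>undirect G\<^esub> u"
  using assms undirect_reachable_sym unfolding components_def pre_digraph.sccs_verts_def by blast

lemma component_subset_verts: "C \<in> components G \<Longrightarrow> C \<subseteq> verts G"
  unfolding components_def using wf_digraph.sccs_verts_subsets[OF wf_digraph_undirect] by auto

lemma component_exists:
  assumes "v \<in> verts G"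
  obtains C where "C \<in> components G" "v \<in> C"
  using assms wf_digraph.scc_of_in_sccs_verts[OF wf_digraph_undirect, of v]
    wf_digraph.in_scc_of_self[OF wf_digraph_undirect, of v]
  unfolding components_def by auto

end

section \<open>Ranked branchings are oriented rooted spanning forests\<close>

text \<open>A forest of out-trees with roots \<open>N\<close>: every vertex outside \<open>N\<close>
  has exactly one incoming edge, and \<open>rank\<close> certifies that no directed cycle
  exists.\<close>

locale ranked_branching = wf_digraph G for G (structure) +
  fixes N :: "'a set" and rank :: "'a \<Rightarrow> nat"
  assumes rank_less: "e \<in> arcs G \<Longrightarrow> rank (tail G e) < rank (head G e)"
    and head_not_root: "e \<in> arcs G \<Longrightarrow> head G e \<notin> N"
    and head_inj: "inj_on (head G) (arcs G)"
    and in_arc_exists: "v \<in> verts G \<Longrightarrow> v \<notin> N \<Longrightarrow> \<exists>e\<in>arcs G. head G e = v"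
begin

text \<open>
  As indegrees are at most one, a trail that follows some edge forwards cannot turn back later:
  it goes against the orientation first and along the orientation afterwards.
\<close>

lemma undirected_trail_cases:
  assumes "pre_digraph.awalk (undirect G) u p v" "distinct (map fst p)" "p \<noteq> []"
  shows "if snd (hd p) then snd (last p) \<and> rank u < rank v
    else snd (last p) \<or> rank v < rank u"
  using assms
proof (induction p arbitrary: u)
  case (Cons x q)
  interpret U: wf_digraph "undirect G" by (rule wf_digraph_undirect)
  obtain e d where x: "x = (e, d)" by (cases x)
  have e: "e \<in> arcs G" and u: "u = (if d then tail G e else head G e)"
    and q: "U.awalk (if d then head G e else tail G e) q v"
    using Cons.prems(1) by (simp_all add: x U.awalk_Cons_iff)
  show ?case
  proof (cases q)
    case Nil
    then show ?thesis
      using q u x rank_less[OF e] by (auto simp: U.awalk_Nil_iff)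
  next
    case (Cons y q')
    obtain f c where y: "y = (f, c)" by (cases y)
    have f: "f \<in> arcs G" "(if d then head G e else tail G e) = (if c then tail G f else head G f)"
      using q by (simp_all add: Cons y U.awalk_Cons_iff)
    have "c" if "d"
    proof (rule ccontr)
      assume "\<not> c"
      then have "e = f"
        using f that e head_inj by (auto dest: inj_onD)
      then show False
        using Cons.prems(2) by (simp add: x y Cons)
    qed
    moreover note Cons.IH[OF q]
    ultimately show ?thesis
      using Cons.prems(2) u x y rank_less[OF e] Cons by (auto split: if_splits)
  qed
qed simp

text \<open>A closed trail returns to its initial rank, so it starts against the orientation and
  ends along it. Its first and last edges then share their head, hence coincide, although a trail
  repeats no edge.\<close>

lemma undirected_acyclic: "undirected_acyclic G"
  unfolding undirected_acyclic_def
proof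
  interpret U: wf_digraph "undirect G" by (rule wf_digraph_undirect)
  assume "\<exists>p. U.cycle p \<and> distinct (map fst p)"
  then obtain p u where p: "U.awalk u p u" "p \<noteq> []" "distinct (map fst p)"
    by (auto simp: U.cycle_def)
  from undirected_trail_cases[OF p(1,3,2)]
  have dirs: "\<not> snd (hd p)" "snd (last p)"
    by (auto split: if_splits)
  obtain e q where pq: "p = (e, False) # q"
    using p(2) dirs(1) by (cases p) auto
  have "q \<noteq> []" using dirs(2) pq by auto
  then obtain q' e' where q: "q = q' @ [(e', True)]"
    using dirs(2) pq by (cases q rule: rev_cases) auto
  have "e \<in> arcs G" "e' \<in> arcs G" "head G e = head G e'"
    using p(1) by (auto simp: pq q U.awalk_simps)
  then have "e = e'" using head_inj by (auto dest: inj_onD)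
  then show False using p(3) by (simp add: pq q)
qed

text \<open>Following incoming edges backwards lowers the rank, so the descent stops, and it can
  only stop in \<open>N\<close>.\<close>

lemma root_exists:
  assumes "v \<in> verts G"
  shows "\<exists>r\<in>N. r \<rightarrow>\<^sup>* v"
  using assms
proof (induction "rank v" arbitrary: v rule: less_induct)
  case less
  show ?case
  proof (cases "v \<in> N")
    case False
    then obtain e where e: "e \<in> arcs G" "head G e = v"
      using in_arc_exists less.prems by blast
    then obtain r where "r \<in> N" "r \<rightarrow>\<^sup>* tail G e"
      using less.hyps[of "tail G e"] rank_less by auto
    moreover have "tail G e \<rightarrow> v"
      using e in_arcs_imp_in_arcs_ends by auto
    ultimately show ?thesis
      by (auto intro: reachable_adj_trans)
  qed (use less.prems in auto)
qed

text \<open>A directed walk from a root to the head of \<open>e\<close> is nonempty, and its last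
  edge can only be \<open>e\<close>; so it passes through the tail.\<close>

lemma root_of_tail_iff_root_of_head:
  assumes "e \<in> arcs G" "r \<in> N"
  shows "r \<rightarrow>\<^sup>* tail G e \<longleftrightarrow> r \<rightarrow>\<^sup>* head G e"
proof
  assume "r \<rightarrow>\<^sup>* tail G e"
  then show "r \<rightarrow>\<^sup>* head G e"
    using assms(1) by (auto intro: reachable_adj_trans in_arcs_imp_in_arcs_ends)
next
  assume "r \<rightarrow>\<^sup>* head G e"
  then obtain p where p: "awalk r p (head G e)"
    unfolding reachable_awalk by blast
  have "p \<noteq> []"
    using p assms head_not_root by (auto simp: awalk_Nil_iff)
  then obtain q f where q: "p = q @ [f]"
    by (cases p rule: rev_cases) auto
  have "f \<in> arcs G" "head G f = head G e" "awalk r q (tail G f)"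
    using p by (auto simp: q awalk_simps)
  moreover from this have "f = e"
    using head_inj assms(1) by (auto dest: inj_onD)
  ultimately show "r \<rightarrow>\<^sup>* tail G e"
    by (auto intro: reachable_awalkI)
qed

text \<open>Directed reachability from a root is invariant across each single edge, hence constant
  on components.\<close>

lemma root_iff_of_connected:
  assumes "u \<rightarrow>\<^sup>*\<^bsub>undirect G\<^esub> v" "r \<in> N"
  shows "r \<rightarrow>\<^sup>* u \<longleftrightarrow> r \<rightarrow>\<^sup>* v"
  using assms(1)
proof (induction rule: wf_digraph.reachable_induct[OF wf_digraph_undirect, consumes 1, case_names base step])
  case (step x y)
  from \<open>x \<rightarrow>\<^bsub>undirect G\<^esub> y\<close> obtain e where "e \<in> arcs G" "{x, y} = {tail G e, head G e}"
    by (rule undirect_dominatesE)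
  then have "r \<rightarrow>\<^sup>* x \<longleftrightarrow> r \<rightarrow>\<^sup>* y"
    using root_of_tail_iff_root_of_head[OF _ assms(2)] by (auto simp: doubleton_eq_iff)
  with step show ?case by simp
qed simp

lemma reachable_root_eq:
  assumes "u \<rightarrow>\<^sup>* r" "r \<in> N"
  shows "u = r"
  using assms(1)
proof (cases rule: rtrancl_on.cases[OF assms(1)[unfolded reachable_def]])
  case (2 b c)
  then show ?thesis using assms(2) head_not_root by auto
qed auto

lemma root_reaches_component:
  assumes "C \<in> components G" "r \<in> C" "r \<in> N" "v \<in> C"
  shows "r \<rightarrow>\<^sup>* v"
proof -
  have "r \<rightarrow>\<^sup>*\<^bsub>undirect G\<^esub> v"
    using assms component_iff by blast
  moreover have "r \<rightarrow>\<^sup>* r"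
    using assms component_subset_verts by auto
  ultimately show ?thesis
    using root_iff_of_connected assms(3) by blast
qed

lemma component_root_unique:
  assumes C: "C \<in> components G"
  shows "\<exists>!r. r \<in> C \<inter> N"
proof (rule ex_ex1I)
  obtain v where v: "v \<in> C"
    using C unfolding components_def pre_digraph.sccs_verts_def by auto
  then obtain r where r: "r \<in> N" "r \<rightarrow>\<^sup>* v"
    using root_exists component_subset_verts[OF C] by blast
  then have "v \<rightarrow>\<^sup>*\<^bsub>undirect G\<^esub> r"
    using reachable_imp_undirect_reachable undirect_reachable_sym by blast
  then show "\<exists>r. r \<in> C \<inter> N"
    using r component_iff[OF C v] by auto
next
  fix r s assume "r \<in> C \<inter> N" "s \<in> C \<inter> N"
  then have "r \<rightarrow>\<^sup>* s"
    using root_reaches_component[OF C] by blast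
  then show "r = s"
    using reachable_root_eq \<open>s \<in> C \<inter> N\<close> by blast
qed

text \<open>The head of \<open>e\<close> outranks every vertex visited so far, so it is new and the
  path stays simple. The rank bound is the invariant for building paths edge by edge.\<close>

lemma rank_bounded_apath_snoc:
  assumes "pre_digraph.apath (undirect G) r p (tail G e)" "e \<in> arcs G"
    and "\<forall>x\<in>set (pre_digraph.awalk_verts (undirect G) r p). rank x \<le> rank (tail G e)"
  shows "pre_digraph.apath (undirect G) r (p @ [(e, True)]) (head G e)"
    and "\<forall>x\<in>set (pre_digraph.awalk_verts (undirect G) r (p @ [(e, True)])). rank x \<le> rank (head G e)"
proof -
  interpret U: wf_digraph "undirect G" by (rule wf_digraph_undirect)
  have *: "U.awlast r p = tail G e"
    using assms(1) by (auto simp: U.apath_def)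
  have "head G e \<notin> set (U.awalk_verts r p)"
    using assms(3) rank_less[OF assms(2)] by auto
  then show ap: "U.apath r (p @ [(e, True)]) (head G e)"
    using assms(1,2) rank_less[OF assms(2)] by (auto simp: U.apath_append_iff * U.apath_simps)
  have "U.awalk r (p @ [(e, True)]) (head G e)"
    using ap by (simp only: U.apath_def)
  from U.awalk_verts_append[OF this]
  show "\<forall>x\<in>set (U.awalk_verts r (p @ [(e, True)])). rank x \<le> rank (head G e)"
    using assms(3) rank_less[OF assms(2)] by (auto simp: *)
qed

lemma rank_bounded_apath_exists:
  assumes "r \<rightarrow>\<^sup>* v"
  shows "\<exists>p. pre_digraph.apath (undirect G) r p v \<and>
    (\<forall>x\<in>set (pre_digraph.awalk_verts (undirect G) r p). rank x \<le> rank v)"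
  using assms
proof (induction rule: reachable_induct)
  interpret U: wf_digraph "undirect G" by (rule wf_digraph_undirect)
  case base
  then show ?case
    by (intro exI[of _ "[]"]) (simp add: U.apath_Nil_iff)
next
  case (step x y)
  obtain e where e: "e \<in> arcs G" "x = tail G e" "y = head G e"
    using step.hyps(2) by auto
  with step.IH show ?case
    using rank_bounded_apath_snoc by blast
qed

theorem oriented_rooted_spanning_forest:
  assumes "spanning G K"
  shows "oriented_rooted_spanning_forest K N G"
  unfolding oriented_rooted_spanning_forest_def rooted_spanning_forest_def oriented_away_def
proof (intro conjI ballI impI)
  fix C r e assume "C \<in> components G" "r \<in> C \<inter> N" "e \<in> arcs G" "tail G e \<in> C"
  then show "\<exists>p. pre_digraph.apath (undirect G) r (p @ [(e, True)]) (head G e)"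
    using rank_bounded_apath_exists rank_bounded_apath_snoc(1) root_reaches_component by blast
qed (use assms undirected_acyclic component_root_unique in auto)

end

section \<open>The forests of the cycle with pendant edges\<close>

text \<open>The test for the cycle edge with index \<open>i\<close> concerns its head
  \<open>i mod n + 1\<close>, not its tail, so that each internal vertex receives exactly one
  edge.\<close>

definition pendant_forest :: "nat \<Rightarrow> nat set \<Rightarrow> (pendant_vertex, pendant_edge) pre_digraph" where
  "pendant_forest n S = (pendant_cycle n)\<lparr>arcs :=
     Pendant_Edge ` S \<union> Cycle_Edge ` {i \<in> {1..n}. i mod n + 1 \<notin> S}\<rparr>"

lemma pendant_cycle_simps [simp]:
  "verts (pendant_cycle n) = Internal ` {1..n} \<union> Node ` {1..n}"
  "arcs (pendant_cycle n) = Cycle_Edge ` {1..n} \<union> Pendant_Edge ` {1..n}"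
  "tail (pendant_cycle n) = pendant_tail"
  "head (pendant_cycle n) = pendant_head n"
  by (simp_all add: pendant_cycle_def)

lemma pendant_forest_simps [simp]:
  "verts (pendant_forest n S) = Internal ` {1..n} \<union> Node ` {1..n}"
  "arcs (pendant_forest n S) =
    Pendant_Edge ` S \<union> Cycle_Edge ` {i \<in> {1..n}. i mod n + 1 \<notin> S}"
  "tail (pendant_forest n S) = pendant_tail"
  "head (pendant_forest n S) = pendant_head n"
  by (simp_all add: pendant_forest_def)

lemma bij_betw_cyclic_succ: "bij_betw (\<lambda>i. i mod n + 1) {1..n} {1..n::nat}"
proof -
  have "inj_on (\<lambda>i. i mod n + 1) {1..n}"
  proof (rule inj_onI)
    fix i j assume "i \<in> {1..n}" "j \<in> {1..n}" "i mod n + 1 = j mod n + 1"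
    then show "i = j"
      by (cases "i = n"; cases "j = n") auto
  qed
  moreover have "(\<lambda>i. i mod n + 1) ` {1..n} \<subseteq> {1..n}"
    by (auto simp: Suc_le_eq)
  ultimately show ?thesis
    by (simp add: bij_betw_def endo_inj_surj)
qed

lemma cyclic_succ_inj:
  "i mod n + 1 = j mod n + 1 \<Longrightarrow> i \<in> {1..n} \<Longrightarrow> j \<in> {1..n} \<Longrightarrow> i = (j::nat)"
  using bij_betw_cyclic_succ[of n] by (auto simp: bij_betw_def dest: inj_onD)

lemma inj_on_pendant_forest: "inj_on (pendant_forest n) (Pow {1..n})"
proof (rule inj_onI)
  fix S T assume "pendant_forest n S = pendant_forest n T"
  then have "Pendant_Edge -` arcs (pendant_forest n S) = Pendant_Edge -` arcs (pendant_forest n T)"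
    by simp
  then show "S = T"
    by auto
qed

lemma spanning_pendant_forest:
  assumes "S \<subseteq> {1..n}"
  shows "spanning (pendant_forest n S) (pendant_cycle n)"
proof -
  interpret fin_digraph "pendant_cycle n" by (rule fin_digraph_pendant_cycle)
  have sub: "arcs (pendant_forest n S) \<subseteq> arcs (pendant_cycle n)"
    using assms by auto
  have "wf_digraph (pendant_forest n S)"
  proof
    fix e assume "e \<in> arcs (pendant_forest n S)"
    with sub have "e \<in> arcs (pendant_cycle n)" by blast
    then show "tail (pendant_forest n S) e \<in> verts (pendant_forest n S)"
      and "head (pendant_forest n S) e \<in> verts (pendant_forest n S)"
      using tail_in_verts[of e] head_in_verts[of e] by simp_all
  qed
  then show ?thesis
    using sub wf_digraph by (simp add: spanning_def subgraph_def compatible_def)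
qed

text \<open>The distance from \<open>s\<close> to \<open>i\<close> along the cycle, shifted by one to make room for the nodes.\<close>

fun pendant_rank :: "nat \<Rightarrow> nat \<Rightarrow> pendant_vertex \<Rightarrow> nat" where
  "pendant_rank n s (Node i) = 0"
| "pendant_rank n s (Internal i) = Suc (if s \<le> i then i - s else i + n - s)"

text \<open>The distance from \<open>s\<close> grows by one at each step, including the wrap from
  \<open>n\<close> to 1, and drops only on the step into \<open>s\<close>.\<close>

lemma pendant_rank_cyclic_succ:
  assumes "i \<in> {1..n}" "s \<in> {1..n}" "i mod n + 1 \<noteq> s"
  shows "pendant_rank n s (Internal i) < pendant_rank n s (Internal (i mod n + 1))"
  using assms by (cases "i = n") (auto simp: Suc_le_eq)

lemma oriented_rooted_spanning_forest_pendant_forest: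
  assumes S: "S \<subseteq> {1..n}" "S \<noteq> {}"
  shows "oriented_rooted_spanning_forest (pendant_cycle n) (Node ` {1..n}) (pendant_forest n S)"
proof -
  \<comment> \<open>Any element of \<open>S\<close> can be the origin of the rank: the cycle edge
    into it, the only one that would lower the rank, is absent.\<close>
  obtain s where s: "s \<in> S" using S by blast
  interpret wf_digraph "pendant_forest n S"
    using spanning_pendant_forest[OF S(1)] by (simp add: spanning_def subgraph_def)
  interpret ranked_branching "pendant_forest n S" "Node ` {1..n}" "pendant_rank n s"
  proof
    fix e assume e: "e \<in> arcs (pendant_forest n S)"
    show "pendant_rank n s (tail (pendant_forest n S) e) < pendant_rank n s (head (pendant_forest n S) e)"
    proof (cases e)
      case (Cycle_Edge i)
      then have "i \<in> {1..n}" "i mod n + 1 \<noteq> s" "s \<in> {1..n}"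
        using e s S by auto
      then show ?thesis
        using pendant_rank_cyclic_succ Cycle_Edge by simp
    qed simp
    show "head (pendant_forest n S) e \<notin> Node ` {1..n}"
      using e by auto
  next
    show "inj_on (head (pendant_forest n S)) (arcs (pendant_forest n S))"
      by (rule inj_onI) (auto intro: cyclic_succ_inj[of _ n])
  next
    fix v assume v: "v \<in> verts (pendant_forest n S)" "v \<notin> Node ` {1..n}"
    then obtain j where j: "v = Internal j" "j \<in> {1..n}" by auto
    have "j \<in> (\<lambda>i. i mod n + 1) ` {1..n}"
      using j(2) bij_betw_cyclic_succ[of n] by (simp add: bij_betw_def)
    then obtain i where i: "i \<in> {1..n}" "j = i mod n + 1" by blast
    show "\<exists>e\<in>arcs (pendant_forest n S). head (pendant_forest n S) e = v"
    proof (cases "j \<in> S")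
      case True
      then show ?thesis
        by (intro bexI[of _ "Pendant_Edge j"]) (auto simp: j)
    next
      case False
      then show ?thesis
        using i by (intro bexI[of _ "Cycle_Edge i"]) (auto simp: j)
    qed
  qed
  show ?thesis
    by (rule oriented_rooted_spanning_forest[OF spanning_pendant_forest[OF S(1)]])
qed

section \<open>Every oriented forest comes from a nonempty set\<close>

context
  fixes n H
  assumes n: "n \<ge> 1"
    and forest: "oriented_rooted_spanning_forest (pendant_cycle n) (Node ` {1..n}) H"
begin

interpretation wf_digraph H
  using forest by (simp add: oriented_rooted_spanning_forest_def rooted_spanning_forest_def
      spanning_def subgraph_def)

interpretation U: wf_digraph "undirect H"
  by (rule wf_digraph_undirect)

lemma forest_simps:
  "verts H = Internal ` {1..n} \<union> Node ` {1..n}"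
  "arcs H \<subseteq> Cycle_Edge ` {1..n} \<union> Pendant_Edge ` {1..n}"
  "tail H = pendant_tail" "head H = pendant_head n"
  using forest by (simp_all add: oriented_rooted_spanning_forest_def rooted_spanning_forest_def
      spanning_def subgraph_def compatible_def)

lemma internal_vertex_has_node:
  assumes "j \<in> {1..n}"
  obtains C k where "C \<in> components H" "Internal j \<in> C" "Node k \<in> C" "k \<in> {1..n}"
proof -
  obtain C where C: "C \<in> components H" "Internal j \<in> C"
    using assms component_exists[of "Internal j"] forest_simps(1) by auto
  then have "\<exists>!r. r \<in> C \<inter> Node ` {1..n}"
    using forest by (simp add: oriented_rooted_spanning_forest_def rooted_spanning_forest_def)
  then show ?thesis using that C by blast
qed

lemma forest_oriented_away:
  assumes "C \<in> components H" "Node k \<in> C" "k \<in> {1..n}" "e \<in> arcs H" "tail H e \<in> C"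
  obtains p where "U.apath (Node k) (p @ [(e, True)]) (head H e)"
  using assms forest unfolding oriented_rooted_spanning_forest_def oriented_away_def by blast

text \<open>The only edge that can meet a node is its own pendant edge, which points away from
  it.\<close>

lemma walk_from_node:
  assumes "U.awalk (Node k) p v" "p \<noteq> []"
  obtains q where "p = (Pendant_Edge k, True) # q" "Pendant_Edge k \<in> arcs H"
proof -
  obtain e d q where p: "p = (e, d) # q" using assms(2) by (cases p) auto
  then have "e \<in> arcs H" "Node k = (if d then tail H e else head H e)"
    using assms(1) by (auto simp: U.awalk_Cons_iff)
  then show ?thesis
    using that p by (cases e) (auto simp: forest_simps split: if_splits)
qed

text \<open>Without an incoming edge, v_j could be reached from a node only backwards through its
  outgoing cycle edge. That edge would then not be oriented away from the node.\<close>

lemma in_edge_exists: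
  assumes j: "j \<in> {1..n}"
  shows "\<exists>e\<in>arcs H. head H e = Internal j"
proof (rule ccontr)
  assume no: "\<not> ?thesis"
  have last_edge: "\<exists>q. p = q @ [(Cycle_Edge j, False)] \<and> Cycle_Edge j \<in> arcs H"
    if "U.awalk (Node k) p (Internal j)" for p k
  proof -
    have "p \<noteq> []" using that by (auto simp: U.awalk_Nil_iff)
    then obtain q e d where p: "p = q @ [(e, d)]"
      by (cases p rule: rev_cases) auto
    have "e \<in> arcs H" "(if d then head H e else tail H e) = Internal j"
      using that by (auto simp: p U.awalk_simps)
    then show ?thesis
      using no p by (cases e) (auto simp: forest_simps split: if_splits)
  qed
  let ?e = "Cycle_Edge j"
  obtain C k where C: "C \<in> components H" "Internal j \<in> C" "Node k \<in> C" "k \<in> {1..n}"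
    using internal_vertex_has_node[OF j] .
  obtain p where "U.awalk (Node k) p (Internal j)"
    using component_iff[OF C(1,3)] C(2) U.reachable_awalk by blast
  then have "?e \<in> arcs H" using last_edge by blast
  moreover have tail: "tail H ?e = Internal j"
    by (simp add: forest_simps)
  ultimately obtain p where p: "U.apath (Node k) (p @ [(?e, True)]) (head H ?e)"
    using forest_oriented_away[OF C(1,3,4)] C(2) by metis
  then have "U.awalk (Node k) p (Internal j)"
    using tail by (auto simp: U.apath_def U.awalk_simps)
  \<comment> \<open>The part of the path before the final arc is itself a walk into v_j, so it ends
    with the same edge traversed backwards.\<close>
  then obtain q where "p = q @ [(?e, False)]"
    using last_edge by blast
  with p have "U.apath (Node k) (q @ [(?e, False), (?e, True)]) (head H ?e)"
    by simp
  then have "U.apath (head H ?e) [(?e, False), (?e, True)] (head H ?e)"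
    unfolding U.apath_append_iff by (auto simp: U.apath_Cons_iff)
  then show False
    using U.apath_nonempty_ends by blast
qed

text \<open>With the pendant edge present, a path from that node is at v_j after one step, so it
  cannot enter v_j again through the cycle edge.\<close>

lemma in_edge_unique:
  assumes "Pendant_Edge (i mod n + 1) \<in> arcs H" "Cycle_Edge i \<in> arcs H"
  shows False
proof -
  let ?j = "i mod n + 1"
  have j: "?j \<in> {1..n}" using assms(1) forest_simps(2) by auto
  obtain C where C: "C \<in> components H" "Internal ?j \<in> C"
    using internal_vertex_has_node[OF j] by blast
  have "Node ?j \<in> C" "Internal i \<in> C"
    unfolding component_iff[OF C]
    using undirect_dominates(2)[OF assms(1)] undirect_dominates(2)[OF assms(2)]
    by (simp_all add: forest_simps U.reachable_adjI)
  then obtain p where p: "U.apath (Node ?j) (p @ [(Cycle_Edge i, True)]) (Internal ?j)"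
    using forest_oriented_away[OF C(1) _ j assms(2)] by (auto simp: forest_simps)
  then obtain q where q: "p @ [(Cycle_Edge i, True)] = (Pendant_Edge ?j, True) # q"
    using walk_from_node U.apath_def by (metis Nil_is_append_conv not_Cons_self2)
  \<comment> \<open>The pendant edge and the final cycle edge differ, so something remains after the
    first arc; it is a nonempty closed path at v_j, which is impossible.\<close>
  then have "q \<noteq> []" by (cases p) auto
  moreover have "U.apath (Internal ?j) q (Internal ?j)"
    using p unfolding q U.apath_Cons_iff by (simp add: forest_simps)
  ultimately show False
    using U.apath_nonempty_ends by blast
qed

text \<open>The pendant edges of \<open>H\<close> determine \<open>S\<close>. A cycle edge whose
  head lies in \<open>S\<close> is excluded by uniqueness of incoming edges, and all other cycle
  edges are forced by existence.\<close>

lemma forest_is_pendant_forest: "H \<in> pendant_forest n ` (Pow {1..n} - {{}})"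
proof (rule image_eqI)
  define S where "S = {i. Pendant_Edge i \<in> arcs H}"
  \<comment> \<open>The choice of v_1 is arbitrary: any internal vertex is joined to some node, and
    the pendant edge of that node shows that \<open>S\<close> is nonempty.\<close>
  have "1 \<in> {1..n}" using n by simp
  then obtain C k where C: "C \<in> components H" "Internal 1 \<in> C" "Node k \<in> C"
    using internal_vertex_has_node by blast
  then obtain p where p: "U.awalk (Node k) p (Internal 1)"
    using component_iff[OF C(1,3)] U.reachable_awalk by blast
  then have "p \<noteq> []" by (auto simp: U.awalk_Nil_iff)
  then have "k \<in> S" using walk_from_node[OF p] by (auto simp: S_def)
  then show "S \<in> Pow {1..n} - {{}}"
    using forest_simps(2) by (auto simp: S_def)
  have cyc: "Cycle_Edge i \<in> arcs H \<longleftrightarrow> i mod n + 1 \<notin> S" if i: "i \<in> {1..n}" for i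
  proof
    show "i mod n + 1 \<notin> S" if "Cycle_Edge i \<in> arcs H"
      using in_edge_unique that by (auto simp: S_def)
  next
    assume notin: "i mod n + 1 \<notin> S"
    have "i mod n + 1 \<in> {1..n}"
      using bij_betwE[OF bij_betw_cyclic_succ] i by blast
    then obtain e where e: "e \<in> arcs H" "head H e = Internal (i mod n + 1)"
      using in_edge_exists by blast
    show "Cycle_Edge i \<in> arcs H"
    proof (cases e)
      case (Cycle_Edge i')
      then have "i' \<in> {1..n}" using e(1) forest_simps(2) by auto
      moreover have "i' mod n + 1 = i mod n + 1"
        using e(2) Cycle_Edge by (simp add: forest_simps)
      ultimately have "i' = i" using cyclic_succ_inj i by blast
      then show ?thesis using e(1) Cycle_Edge by simp
    next
      case (Pendant_Edge i')
      then show ?thesis using e notin by (auto simp: forest_simps S_def)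
    qed
  qed
  have "arcs H = Pendant_Edge ` S \<union> Cycle_Edge ` {i \<in> {1..n}. i mod n + 1 \<notin> S}"
    using forest_simps(2) cyc by (auto simp: S_def)
  then show "H = pendant_forest n S"
    by (simp add: forest_simps pre_digraph.equality)
qed

end

section \<open>The weighted sum over subsets\<close>

lemma oriented_rooted_spanning_forests_pendant_cycle:
  assumes "n \<ge> 1"
  shows "{H. oriented_rooted_spanning_forest (pendant_cycle n) (Node ` {1..n}) H} =
    pendant_forest n ` (Pow {1..n} - {{}})"
  using forest_is_pendant_forest[OF assms] oriented_rooted_spanning_forest_pendant_forest by auto

text \<open>Sending each cycle edge to the index of its head matches the cycle edges present with
  the complement of \<open>S\<close>. The weight is left as two products to fit the expansion of a
  product of sums.\<close>

lemma prod_pendant_weight: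
  fixes a b :: "'r::comm_ring_1"
  assumes "S \<subseteq> {1..n}"
  shows "prod (pendant_weight a b) (arcs (pendant_forest n S)) =
    (\<Prod>i\<in>S. a) * (\<Prod>i\<in>{1..n} - S. b)"
proof -
  let ?T = "{i \<in> {1..n}. i mod n + 1 \<notin> S}"
  let ?f = "\<lambda>i. i mod n + 1"
  have "?f ` ?T = ?f ` {1..n} - S"
    by blast
  also have "\<dots> = {1..n} - S"
    by (simp only: bij_betw_imp_surj_on[OF bij_betw_cyclic_succ])
  finally have "bij_betw ?f ?T ({1..n} - S)"
    by (rule bij_betw_subset[OF bij_betw_cyclic_succ, rotated]) blast
  then have "card ?T = card ({1..n} - S)"
    by (rule bij_betw_same_card)
  moreover have "finite S"
    using assms finite_subset by auto
  moreover have "inj_on Pendant_Edge S" "inj_on Cycle_Edge ?T"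
    by (auto simp: inj_on_def)
  ultimately show ?thesis
    by (subst pendant_forest_simps(2), subst prod.union_disjoint) (auto simp: prod.reindex)
qed

theorem theorem3p9:
  fixes n :: nat and a b :: "'r::comm_ring_1"
  assumes "n \<ge> 1"
  shows "F_tilde n a b = (a + b) ^ n - b ^ n"
proof -
  let ?f = "\<lambda>S. (\<Prod>i\<in>S. a) * (\<Prod>i\<in>{1..n} - S. b)"
  have "F_tilde n a b =
      (\<Sum>S\<in>Pow {1..n} - {{}}. prod (pendant_weight a b) (arcs (pendant_forest n S)))"
    unfolding F_tilde_def Z_ori_def oriented_rooted_spanning_forests_pendant_cycle[OF assms]
    by (subst sum.reindex[OF inj_on_subset[OF inj_on_pendant_forest]]) auto
  also have "\<dots> = (\<Sum>S\<in>Pow {1..n} - {{}}. ?f S)"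
    by (intro sum.cong prod_pendant_weight) auto
  \<comment> \<open>The empty set is put back so that the sum runs over all choices of
    \<open>a\<close> or \<open>b\<close> at each index; its own term is
    \<open>b ^ n\<close>.\<close>
  also have "\<dots> = (\<Sum>S\<in>Pow {1..n}. ?f S) - ?f {}"
    by (simp add: sum_diff1)
  also have "(\<Sum>S\<in>Pow {1..n}. ?f S) = (a + b) ^ n"
    using prod_add[of "{1..n}" "\<lambda>_. a" "\<lambda>_. b"] by simp
  finally show ?thesis
    by simp
qed

end
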